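(* Let $(\mathcal X,\mathcal A)$ be a measurable space, let $(\mathcal P_\eta:\eta\in H)$ be an exhaustion of a model $\mathcal P\subseteq\mathrm{Prob}(\mathcal X,\mathcal A)$, and let $\mathcal O$ and $\mathcal O_\eta$ respectively denote the optimal $\sigma$-algebras of $\mathcal P$ and of $\mathcal P_\eta$ for $\eta\in H$. Then $\bigcap_{\eta\in H}\mathcal O_\eta\subseteq\mathcal O$.
   Context: $\mathrm{Prob}(\mathcal X,\mathcal A)$ denotes the set of all probability measures (laws) on $(\mathcal X,\mathcal A)$. A model on $(\mathcal X,\mathcal A)$ is a subset $\mathcal P\subseteq\mathrm{Prob}(\mathcal X,\mathcal A)$; a submodel is a subset of $\mathcal P$. An exhaustion of $\mathcal P$ is a family $(\mathcal P_\eta:\eta\in H)$ of submodels of $\mathcal P$ with $\bigcup_{\eta\in H}\mathcal P_\eta=\mathcal P$. For a law $P$ and a function $h$, $Ph$ denotes $\int h\,dP$. For a model $\mathcal P$ on $(\mathcal X,\mathcal A)$, let $\mathcal E_0(\mathcal P)$ be the set of all measurable functions $h:\mathcal X\to\mathbb R$ that are integrable with respect to every $P\in\mathcal P$ and satisfy $Ph=0$ for every $P\in\mathcal P$ (the unbiased estimators of zero). The optimal $\sigma$-algebra of $\mathcal P$ is $$\{A\in\mathcal A: P(\mathbf 1_A h)=0\ \text{ for all } h\in\mathcal E_0(\mathcal P)\text{ and all }P\in\mathcal P\},$$ which is indeed a sub-$\sigma$-algebra of $\mathcal A$. The optimal $\sigma$-algebra of $\mathcal P_\eta$ is defined in the same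 way with $\mathcal P_\eta$ in place of $\mathcal P$ throughout. *)

theory Defs
  imports "HOL-Probability.Probability"
begin

text \<open>
  A measurable space is represented by a value \<open>M :: 'x measure\<close> of which only
  \<open>space M\<close> and \<open>sets M\<close> are used; the measure it carries plays no role.
  The set of all laws on it is \<open>space (prob_algebra M)\<close>, that is, the set of all
  probability spaces \<open>P\<close> with \<open>sets P = sets M\<close> (see \<open>space_prob_algebra\<close>).
\<close>

definition is_model :: "'x measure \<Rightarrow> 'x measure set \<Rightarrow> bool" where
  "is_model M \<P> \<longleftrightarrow> \<P> \<subseteq> space (prob_algebra M)"

definition is_exhaustion ::
    "'x measure set \<Rightarrow> 'i set \<Rightarrow> ('i \<Rightarrow> 'x measure set) \<Rightarrow> bool" where
  "is_exhaustion \<P> H \<P>' \<longleftrightarrow> (\<forall>\<eta>\<in>H. \<P>' \<eta> \<subseteq> \<P>) \<and> (\<Union>\<eta>\<in>H. \<P>' \<eta>) = \<P>"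

definition unbiased_zero_estimators ::
    "'x measure \<Rightarrow> 'x measure set \<Rightarrow> ('x \<Rightarrow> real) set" where
  "unbiased_zero_estimators M \<P> =
     {h \<in> borel_measurable M. \<forall>P\<in>\<P>. integrable P h \<and> (\<integral>x. h x \<partial>P) = 0}"

definition optimal_sigma_algebra :: "'x measure \<Rightarrow> 'x measure set \<Rightarrow> 'x set set" where
  "optimal_sigma_algebra M \<P> =
     {A \<in> sets M. \<forall>h\<in>unbiased_zero_estimators M \<P>. \<forall>P\<in>\<P>.
        (\<integral>x. indicator A x * h x \<partial>P) = 0}"

end

theory Submission
  imports Defs
begin

text \<open>
  Shrinking a model weakens both demands on an unbiased estimator of zero, so
  \<open>unbiased_zero_estimators\<close> is antitone in the model. Membership in an optimal
  \<open>\<sigma>\<close>-algebra is tested against one law at a time, and each law of \<open>\<P>\<close> lies in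
  some submodel of the exhaustion. An estimator to be tested for \<open>\<P>\<close> is
  therefore already among those tested for that submodel.
\<close>

lemma unbiased_zero_estimators_antimono:
  assumes "\<Q> \<subseteq> \<P>"
  shows "unbiased_zero_estimators M \<P> \<subseteq> unbiased_zero_estimators M \<Q>"
  using assms by (auto simp: unbiased_zero_estimators_def)

theorem theorem3p4:
  fixes M :: "'x measure" and \<P> :: "'x measure set"
    and H :: "'i set" and \<P>' :: "'i \<Rightarrow> 'x measure set"
  assumes "is_model M \<P>"
    and "is_exhaustion \<P> H \<P>'"
  shows "sets M \<inter> (\<Inter>\<eta>\<in>H. optimal_sigma_algebra M (\<P>' \<eta>)) \<subseteq> optimal_sigma_algebra M \<P>"
proof
  fix A
  assume A: "A \<in> sets M \<inter> (\<Inter>\<eta>\<in>H. optimal_sigma_algebra M (\<P>' \<eta>))"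
  have "(\<integral>x. indicator A x * h x \<partial>P) = 0"
    if h: "h \<in> unbiased_zero_estimators M \<P>" and P: "P \<in> \<P>" for h P
  proof -
    from P assms(2) obtain \<eta> where \<eta>: "\<eta> \<in> H" "P \<in> \<P>' \<eta>" "\<P>' \<eta> \<subseteq> \<P>"
      unfolding is_exhaustion_def by blast
    have "h \<in> unbiased_zero_estimators M (\<P>' \<eta>)"
      using unbiased_zero_estimators_antimono[OF \<eta>(3)] h by blast
    moreover have "A \<in> optimal_sigma_algebra M (\<P>' \<eta>)"
      using A \<eta>(1) by blast
    ultimately show ?thesis
      using \<eta>(2) by (simp add: optimal_sigma_algebra_def)
  qed
  with A show "A \<in> optimal_sigma_algebra M \<P>"
    by (simp add: optimal_sigma_algebra_def)
qed

end
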